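(* Let $R$ be an $F$-finite Noetherian commutative ring of prime characteristic $p$, let $\mathcal D$ be a Cartier subalgebra on $R$, let $J$ be an ideal of $R$, and let $W\subseteq R$ be a multiplicative set avoiding every prime in $\operatorname{Ass}(J)$ (i.e. $W\cap P=\emptyset$ for every $P\in\operatorname{Ass}(J)$). Then $$C_{W^{-1}\mathcal D}(JW^{-1}R)\cap R=C_{\mathcal D}(J)\quad\text{and}\quad C_{\mathcal D}(J)W^{-1}R=C_{W^{-1}\mathcal D}(JW^{-1}R).$$
   Context: $F_*^eR=\{F_*^er:r\in R\}$ denotes $R$ viewed as an $R$-module via the $e$-th iterate of Frobenius: $r\,F_*^es=F_*^e(r^{p^e}s)$ (and $F_*^0R=R$). $R$ is $F$-finite if $F_*R$ is a finitely generated $R$-module. The full Cartier algebra is $\mathcal C_R=\bigoplus_{e\ge0}\operatorname{Hom}_R(F_*^eR,R)$ with multiplication, for $\phi$ of degree $e$ and $\psi$ of degree $d$, $(\phi\cdot\psi)(F_*^{e+d}r)=\phi(F_*^e(\psi(F_*^dr)))$. A Cartier subalgebra $\mathcal D=\bigoplus_e\mathcal D_e$ is a graded subalgebra of $\mathcal C_R$ with $\mathcal D_0=\operatorname{Hom}_R(R,R)=R$. The Cartier core of an ideal $J$ is $C_{\mathcal D}(J)=\{r\in R:\phi(F_*^er)\in J\text{ for all }e>0\text{ and all }\phi\in\mathcal D_e\}$. $\operatorname{Ass}(J)$ is the set of associated primes of $R/J$. For a multiplicative set $W$, $W^{-1}\mathcal D$ is the Cartier subalgebra on $W^{-1}R$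 with $(W^{-1}\mathcal D)_e=W^{-1}R\otimes_R\mathcal D_e\subseteq\operatorname{Hom}_{W^{-1}R}(F_*^e(W^{-1}R),W^{-1}R)$, where $\frac rw\otimes\phi$ is identified with the map $F_*^e\left(\frac su\right)\mapsto\frac{r\,\phi(F_*^e(su^{p^e-1}))}{wu}$. For an ideal $K$ of $W^{-1}R$, $K\cap R$ is its preimage in $R$. *)

theory Defs
  imports "HOL-Algebra.Algebra" "HOL-Computational_Algebra.Primes"
begin

section \<open>Rings of characteristic p and Frobenius push-forwards\<close>

definition has_char :: "('a, 'm) ring_scheme \<Rightarrow> nat \<Rightarrow> bool" where
  "has_char R p \<longleftrightarrow> (\<forall>n::nat. add_pow R n \<one>\<^bsub>R\<^esub> = \<zero>\<^bsub>R\<^esub> \<longleftrightarrow> p dvd n)"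

definition self_module :: "('a, 'm) ring_scheme \<Rightarrow> ('a, 'a) module" where
  "self_module R = \<lparr>carrier = carrier R, monoid.mult = monoid.mult R, one = one R,
     ring.zero = ring.zero R, add = add R, smult = monoid.mult R\<rparr>"

text \<open>The element \<open>F\<^sub>*\<^sup>e s\<close> of \<open>F\<^sub>*\<^sup>e R\<close> is represented by \<open>s\<close> itself; only the scalar action changes.\<close>

definition frob_module :: "('a, 'm) ring_scheme \<Rightarrow> nat \<Rightarrow> nat \<Rightarrow> ('a, 'a) module" where
  "frob_module R p e = \<lparr>carrier = carrier R, monoid.mult = monoid.mult R, one = one R,
     ring.zero = ring.zero R, add = add R, smult = (\<lambda>r s. (r [^]\<^bsub>R\<^esub> (p ^ e)) \<otimes>\<^bsub>R\<^esub> s)\<rparr>"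

definition fin_gen_module :: "('a, 'm) ring_scheme \<Rightarrow> ('a, 'b, 'n) module_scheme \<Rightarrow> bool" where
  "fin_gen_module R M \<longleftrightarrow> (\<exists>A. finite A \<and> A \<subseteq> carrier M \<and>
     (\<forall>x\<in>carrier M. \<exists>c\<in>A \<rightarrow> carrier R. x = (\<Oplus>\<^bsub>M\<^esub>a\<in>A. c a \<odot>\<^bsub>M\<^esub> a)))"

definition F_finite :: "('a, 'm) ring_scheme \<Rightarrow> nat \<Rightarrow> bool" where
  "F_finite R p \<longleftrightarrow> fin_gen_module R (frob_module R p 1)"

text \<open>Homomorphisms are extensional (undefined outside the carrier), so that two of them are equal
  as soon as they agree on the carrier.\<close>

definition module_homs ::
  "('a, 'm) ring_scheme \<Rightarrow> ('a, 'b, 'n) module_scheme \<Rightarrow> ('a, 'c, 'k) module_scheme \<Rightarrow> ('b \<Rightarrow> 'c) set" where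
  "module_homs R M N = {f \<in> carrier M \<rightarrow>\<^sub>E carrier N.
     (\<forall>x\<in>carrier M. \<forall>y\<in>carrier M. f (x \<oplus>\<^bsub>M\<^esub> y) = f x \<oplus>\<^bsub>N\<^esub> f y) \<and>
     (\<forall>r\<in>carrier R. \<forall>x\<in>carrier M. f (r \<odot>\<^bsub>M\<^esub> x) = r \<odot>\<^bsub>N\<^esub> f x)}"


section \<open>Cartier subalgebras and Cartier cores\<close>

text \<open>The additive group of \<open>Hom\<^sub>R(F\<^sub>*\<^sup>e R, R)\<close>, the degree \<open>e\<close> piece of the full Cartier algebra.\<close>

definition cartier_piece :: "('a, 'm) ring_scheme \<Rightarrow> nat \<Rightarrow> nat \<Rightarrow> ('a \<Rightarrow> 'a) monoid" where
  "cartier_piece R p e = \<lparr>carrier = module_homs R (frob_module R p e) (self_module R),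
     monoid.mult = (\<lambda>\<phi> \<psi>. \<lambda>x\<in>carrier R. \<phi> x \<oplus>\<^bsub>R\<^esub> \<psi> x),
     one = (\<lambda>x\<in>carrier R. \<zero>\<^bsub>R\<^esub>)\<rparr>"

text \<open>A graded subalgebra is given by the family of its homogeneous pieces. The product of the full
  Cartier algebra is composition of the underlying maps. Since \<open>D 0\<close> contains all multiplications by
  elements of \<open>R\<close>, closure under products makes every piece an \<open>R\<close>-submodule.\<close>

locale cartier_subalgebra =
  fixes R :: "('a, 'm) ring_scheme" (structure) and p :: nat and D :: "nat \<Rightarrow> ('a \<Rightarrow> 'a) set"
  assumes piece_subgroup: "subgroup (D e) (cartier_piece R p e)"
    and prod_closed: "\<lbrakk>\<phi> \<in> D e; \<psi> \<in> D d\<rbrakk> \<Longrightarrow> compose (carrier R) \<phi> \<psi> \<in> D (e + d)"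
    and degree_zero: "D 0 = carrier (cartier_piece R p 0)"

definition cartier_core :: "('a, 'm) ring_scheme \<Rightarrow> (nat \<Rightarrow> ('a \<Rightarrow> 'a) set) \<Rightarrow> 'a set \<Rightarrow> 'a set" where
  "cartier_core R D J = {r \<in> carrier R. \<forall>e>0. \<forall>\<phi>\<in>D e. \<phi> r \<in> J}"


section \<open>Associated primes\<close>

text \<open>Associated primes of the \<open>R\<close>-module \<open>R/J\<close>; the scalar \<open>r\<close> acts on \<open>R/J\<close> as multiplication by its
  class \<open>J +> r\<close>.\<close>

definition Ass :: "('a, 'm) ring_scheme \<Rightarrow> 'a set \<Rightarrow> 'a set set" where
  "Ass R J = {P. primeideal P R \<and> (\<exists>x\<in>carrier (R Quot J).
     P = {r \<in> carrier R. (J +>\<^bsub>R\<^esub> r) \<otimes>\<^bsub>R Quot J\<^esub> x = \<zero>\<^bsub>R Quot J\<^esub>})}"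


section \<open>Localization\<close>

definition loc_rel :: "('a, 'm) ring_scheme \<Rightarrow> 'a set \<Rightarrow> (('a \<times> 'a) \<times> ('a \<times> 'a)) set" where
  "loc_rel R W = {((a, w), (b, u)). a \<in> carrier R \<and> w \<in> W \<and> b \<in> carrier R \<and> u \<in> W \<and>
     (\<exists>t\<in>W. t \<otimes>\<^bsub>R\<^esub> (a \<otimes>\<^bsub>R\<^esub> u) = t \<otimes>\<^bsub>R\<^esub> (b \<otimes>\<^bsub>R\<^esub> w))}"

definition loc_frac :: "('a, 'm) ring_scheme \<Rightarrow> 'a set \<Rightarrow> 'a \<Rightarrow> 'a \<Rightarrow> ('a \<times> 'a) set" where
  "loc_frac R W a w = loc_rel R W `` {(a, w)}"

text \<open>Operations on fractions are lifted to equivalence classes by taking the union over all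
  representatives, all of which give the same class.\<close>

definition localization :: "('a, 'm) ring_scheme \<Rightarrow> 'a set \<Rightarrow> ('a \<times> 'a) set ring" where
  "localization R W = \<lparr>carrier = (carrier R \<times> W) // loc_rel R W,
     monoid.mult = (\<lambda>U V. \<Union>(a, w)\<in>U. \<Union>(b, u)\<in>V. loc_frac R W (a \<otimes>\<^bsub>R\<^esub> b) (w \<otimes>\<^bsub>R\<^esub> u)),
     one = loc_frac R W \<one>\<^bsub>R\<^esub> \<one>\<^bsub>R\<^esub>,
     ring.zero = loc_frac R W \<zero>\<^bsub>R\<^esub> \<one>\<^bsub>R\<^esub>,
     add = (\<lambda>U V. \<Union>(a, w)\<in>U. \<Union>(b, u)\<in>V.
       loc_frac R W (a \<otimes>\<^bsub>R\<^esub> u \<oplus>\<^bsub>R\<^esub> b \<otimes>\<^bsub>R\<^esub> w) (w \<otimes>\<^bsub>R\<^esub> u))\<rparr>"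

definition loc_map :: "('a, 'm) ring_scheme \<Rightarrow> 'a set \<Rightarrow> 'a \<Rightarrow> ('a \<times> 'a) set" where
  "loc_map R W r = loc_frac R W r \<one>\<^bsub>R\<^esub>"

text \<open>Extension \<open>I W\<^sup>-\<^sup>1R\<close> of an ideal of \<open>R\<close> and contraction \<open>K \<inter> R\<close> of an ideal of \<open>W\<^sup>-\<^sup>1R\<close>.\<close>

definition loc_extension :: "('a, 'm) ring_scheme \<Rightarrow> 'a set \<Rightarrow> 'a set \<Rightarrow> ('a \<times> 'a) set set" where
  "loc_extension R W I = genideal (localization R W) (loc_map R W ` I)"

definition loc_contraction :: "('a, 'm) ring_scheme \<Rightarrow> 'a set \<Rightarrow> ('a \<times> 'a) set set \<Rightarrow> 'a set" where
  "loc_contraction R W K = {r \<in> carrier R. loc_map R W r \<in> K}"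

text \<open>The map \<open>F\<^sub>*\<^sup>e(s/u) \<mapsto> r \<phi>(F\<^sub>*\<^sup>e(s u\<^sup>q\<^sup>-\<^sup>1)) / (w u)\<close>, with \<open>q = p^e\<close>, given by the pure
  tensor \<open>r/w \<otimes> \<phi>\<close>; see \<open>loc_hom_frac\<close> below.\<close>

definition loc_hom :: "('a, 'm) ring_scheme \<Rightarrow> 'a set \<Rightarrow> nat \<Rightarrow> nat \<Rightarrow> 'a \<Rightarrow> 'a \<Rightarrow> ('a \<Rightarrow> 'a)
    \<Rightarrow> ('a \<times> 'a) set \<Rightarrow> ('a \<times> 'a) set" where
  "loc_hom R W p e r w \<phi> = (\<lambda>U\<in>carrier (localization R W). \<Union>(s, u)\<in>U.
     loc_frac R W (r \<otimes>\<^bsub>R\<^esub> \<phi> (s \<otimes>\<^bsub>R\<^esub> u [^]\<^bsub>R\<^esub> (p ^ e - 1))) (w \<otimes>\<^bsub>R\<^esub> u))"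

text \<open>\<open>W\<^sup>-\<^sup>1R \<otimes> D\<^sub>e\<close> consists of the finite sums of pure tensors, so its image in
  \<open>Hom(F\<^sub>*\<^sup>e(W\<^sup>-\<^sup>1R), W\<^sup>-\<^sup>1R)\<close> is the additive subgroup generated by the maps \<^const>\<open>loc_hom\<close>.\<close>

definition loc_cartier :: "('a, 'm) ring_scheme \<Rightarrow> 'a set \<Rightarrow> nat \<Rightarrow> (nat \<Rightarrow> ('a \<Rightarrow> 'a) set)
    \<Rightarrow> nat \<Rightarrow> (('a \<times> 'a) set \<Rightarrow> ('a \<times> 'a) set) set" where
  "loc_cartier R W p D e = generate (cartier_piece (localization R W) p e)
     {loc_hom R W p e r w \<phi> | r w \<phi>. r \<in> carrier R \<and> w \<in> W \<and> \<phi> \<in> D e}"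


section \<open>Well-definedness\<close>

locale cring_mult_set = cring R + submonoid W R for R (structure) and W
begin

lemma W_carrier: "w \<in> W \<Longrightarrow> w \<in> carrier R"
  using subset by blast

lemma loc_rel_equiv: "equiv (carrier R \<times> W) (loc_rel R W)"
proof (rule equivI)
  show "loc_rel R W \<subseteq> (carrier R \<times> W) \<times> carrier R \<times> W"
    by (auto simp: loc_rel_def)
  show "refl_on (carrier R \<times> W) (loc_rel R W)"
    by (auto simp: refl_on_def loc_rel_def intro: one_closed)
  show "sym (loc_rel R W)"
    by (auto simp: sym_def loc_rel_def) metis
  show "trans (loc_rel R W)"
  proof (rule transI)
    fix x y z assume "(x, y) \<in> loc_rel R W" "(y, z) \<in> loc_rel R W"
    then obtain a w b u c v t t' where xyz: "x = (a, w)" "y = (b, u)" "z = (c, v)"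
      and car: "a \<in> carrier R" "b \<in> carrier R" "c \<in> carrier R" "w \<in> W" "u \<in> W" "v \<in> W"
        "t \<in> W" "t' \<in> W"
      and eq: "t \<otimes> (a \<otimes> u) = t \<otimes> (b \<otimes> w)" "t' \<otimes> (b \<otimes> v) = t' \<otimes> (c \<otimes> u)"
      unfolding loc_rel_def by auto
    note car' = car W_carrier[OF car(4)] W_carrier[OF car(5)] W_carrier[OF car(6)]
      W_carrier[OF car(7)] W_carrier[OF car(8)]
    have "(t \<otimes> t' \<otimes> u) \<otimes> (a \<otimes> v) = (t' \<otimes> v) \<otimes> (t \<otimes> (a \<otimes> u))"
      using car' by (simp add: m_ac)
    also have "\<dots> = (t \<otimes> w) \<otimes> (t' \<otimes> (b \<otimes> v))"
      unfolding eq(1) using car' by (simp add: m_ac)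
    also have "\<dots> = (t \<otimes> t' \<otimes> u) \<otimes> (c \<otimes> w)"
      unfolding eq(2) using car' by (simp add: m_ac)
    finally show "(x, z) \<in> loc_rel R W"
      using car unfolding loc_rel_def xyz by (auto intro!: bexI[of _ "t \<otimes> t' \<otimes> u"])
  qed
qed

lemma frac_eq_iff:
  assumes "a \<in> carrier R" "w \<in> W" "b \<in> carrier R" "u \<in> W"
  shows "loc_frac R W a w = loc_frac R W b u \<longleftrightarrow> (\<exists>t\<in>W. t \<otimes> (a \<otimes> u) = t \<otimes> (b \<otimes> w))"
  unfolding loc_frac_def using assms eq_equiv_class_iff[OF loc_rel_equiv, of "(a, w)" "(b, u)"]
  by (auto simp: loc_rel_def)

lemma frac_eqI:
  assumes "a \<in> carrier R" "w \<in> W" "b \<in> carrier R" "u \<in> W" "t \<in> W" "t \<otimes> (a \<otimes> u) = t \<otimes> (b \<otimes> w)"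
  shows "loc_frac R W a w = loc_frac R W b u"
  using assms frac_eq_iff by blast

lemma mem_frac:
  "(b, u) \<in> loc_frac R W a w \<Longrightarrow> b \<in> carrier R \<and> u \<in> W \<and> a \<in> carrier R \<and> w \<in> W \<and> loc_frac R W b u = loc_frac R W a w"
  by (auto simp: loc_frac_def equiv_class_eq_iff[OF loc_rel_equiv])

lemma self_mem_frac: "a \<in> carrier R \<Longrightarrow> w \<in> W \<Longrightarrow> (a, w) \<in> loc_frac R W a w"
  unfolding loc_frac_def using equiv_class_self[OF loc_rel_equiv, of "(a, w)"] by simp

lemma frac_closed [simp, intro]:
  "a \<in> carrier R \<Longrightarrow> w \<in> W \<Longrightarrow> loc_frac R W a w \<in> carrier (localization R W)"
  by (auto simp: localization_def loc_frac_def intro: quotientI)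

lemma locE:
  assumes "U \<in> carrier (localization R W)"
  obtains a w where "a \<in> carrier R" "w \<in> W" "U = loc_frac R W a w"
  using assms by (auto simp: localization_def loc_frac_def elim!: quotientE)

lemma UN_frac:
  assumes "a \<in> carrier R" "w \<in> W" "\<And>b u. (b, u) \<in> loc_frac R W a w \<Longrightarrow> f b u = c"
  shows "(\<Union>(b, u)\<in>loc_frac R W a w. f b u) = c"
  using assms self_mem_frac[OF assms(1,2)] by fastforce

lemma frac_mult:
  assumes "a \<in> carrier R" "w \<in> W" "b \<in> carrier R" "u \<in> W"
  shows "loc_frac R W a w \<otimes>\<^bsub>localization R W\<^esub> loc_frac R W b u = loc_frac R W (a \<otimes> b) (w \<otimes> u)"
proof -
  have *: "loc_frac R W (a' \<otimes> b') (w' \<otimes> u') = loc_frac R W (a \<otimes> b) (w \<otimes> u)"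
    if "(a', w') \<in> loc_frac R W a w" "(b', u') \<in> loc_frac R W b u" for a' w' b' u'
  proof -
    from mem_frac[OF that(1)] mem_frac[OF that(2)] obtain t t' where
      c: "a' \<in> carrier R" "b' \<in> carrier R" "w' \<in> W" "u' \<in> W" "t \<in> W" "t' \<in> W"
      and eq: "t \<otimes> (a' \<otimes> w) = t \<otimes> (a \<otimes> w')" "t' \<otimes> (b' \<otimes> u) = t' \<otimes> (b \<otimes> u')"
      by (metis frac_eq_iff)
    note cc = c assms W_carrier[OF c(3)] W_carrier[OF c(4)] W_carrier[OF c(5)]
      W_carrier[OF c(6)] W_carrier[OF assms(2)] W_carrier[OF assms(4)]
    have "(t \<otimes> t') \<otimes> ((a' \<otimes> b') \<otimes> (w \<otimes> u)) = (t \<otimes> (a' \<otimes> w)) \<otimes> (t' \<otimes> (b' \<otimes> u))"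
      using cc by (simp add: m_ac)
    also have "\<dots> = (t \<otimes> t') \<otimes> ((a \<otimes> b) \<otimes> (w' \<otimes> u'))"
      unfolding eq using cc by (simp add: m_ac)
    finally show ?thesis using cc by (intro frac_eqI[of _ _ _ _ "t \<otimes> t'"]) auto
  qed
  have "(\<Union>(a', w')\<in>loc_frac R W a w. \<Union>(b', u')\<in>loc_frac R W b u. loc_frac R W (a' \<otimes> b') (w' \<otimes> u'))
      = loc_frac R W (a \<otimes> b) (w \<otimes> u)"
    by (rule UN_frac[OF assms(1,2)], rule UN_frac[OF assms(3,4)], rule *)
  then show ?thesis by (simp add: localization_def)
qed

lemma frac_add:
  assumes "a \<in> carrier R" "w \<in> W" "b \<in> carrier R" "u \<in> W"
  shows "loc_frac R W a w \<oplus>\<^bsub>localization R W\<^esub> loc_frac R W b u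
    = loc_frac R W (a \<otimes> u \<oplus> b \<otimes> w) (w \<otimes> u)"
proof -
  have *: "loc_frac R W (a' \<otimes> u' \<oplus> b' \<otimes> w') (w' \<otimes> u') = loc_frac R W (a \<otimes> u \<oplus> b \<otimes> w) (w \<otimes> u)"
    if "(a', w') \<in> loc_frac R W a w" "(b', u') \<in> loc_frac R W b u" for a' w' b' u'
  proof -
    from mem_frac[OF that(1)] mem_frac[OF that(2)] obtain t t' where
      c: "a' \<in> carrier R" "b' \<in> carrier R" "w' \<in> W" "u' \<in> W" "t \<in> W" "t' \<in> W"
      and eq: "t \<otimes> (a' \<otimes> w) = t \<otimes> (a \<otimes> w')" "t' \<otimes> (b' \<otimes> u) = t' \<otimes> (b \<otimes> u')"
      by (metis frac_eq_iff)
    note cc = c assms W_carrier[OF c(3)] W_carrier[OF c(4)] W_carrier[OF c(5)]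
      W_carrier[OF c(6)] W_carrier[OF assms(2)] W_carrier[OF assms(4)]
    have "(t \<otimes> t') \<otimes> ((a' \<otimes> u' \<oplus> b' \<otimes> w') \<otimes> (w \<otimes> u))
      = (t \<otimes> (a' \<otimes> w)) \<otimes> (t' \<otimes> u \<otimes> u') \<oplus> (t' \<otimes> (b' \<otimes> u)) \<otimes> (t \<otimes> w \<otimes> w')"
      using cc by (simp add: m_ac r_distr l_distr)
    also have "\<dots> = (t \<otimes> t') \<otimes> ((a \<otimes> u \<oplus> b \<otimes> w) \<otimes> (w' \<otimes> u'))"
      unfolding eq using cc by (simp add: m_ac r_distr l_distr)
    finally show ?thesis using cc by (intro frac_eqI[of _ _ _ _ "t \<otimes> t'"]) auto
  qed
  have "(\<Union>(a', w')\<in>loc_frac R W a w. \<Union>(b', u')\<in>loc_frac R W b u. loc_frac R W (a' \<otimes> u' \<oplus> b' \<otimes> w') (w' \<otimes> u'))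
      = loc_frac R W (a \<otimes> u \<oplus> b \<otimes> w) (w \<otimes> u)"
    by (rule UN_frac[OF assms(1,2)], rule UN_frac[OF assms(3,4)], rule *)
  then show ?thesis by (simp add: localization_def)
qed

lemma frac_one: "\<one>\<^bsub>localization R W\<^esub> = loc_frac R W \<one> \<one>"
  by (simp add: localization_def)

lemma frac_zero: "\<zero>\<^bsub>localization R W\<^esub> = loc_frac R W \<zero> \<one>"
  by (simp add: localization_def)

lemma localization_cring: "cring (localization R W)"
proof (rule cringI)
  let ?S = "localization R W"
  note W = W_carrier
  show "abelian_group ?S"
  proof (rule abelian_groupI)
    fix x y assume "x \<in> carrier ?S" "y \<in> carrier ?S"
    then show "x \<oplus>\<^bsub>?S\<^esub> y \<in> carrier ?S" "x \<oplus>\<^bsub>?S\<^esub> y = y \<oplus>\<^bsub>?S\<^esub> x"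
      by (auto elim!: locE simp: frac_add W m_comm a_comm)
  next
    show "\<zero>\<^bsub>?S\<^esub> \<in> carrier ?S" by (auto simp: frac_zero)
  next
    fix x y z assume "x \<in> carrier ?S" "y \<in> carrier ?S" "z \<in> carrier ?S"
    then show "x \<oplus>\<^bsub>?S\<^esub> y \<oplus>\<^bsub>?S\<^esub> z = x \<oplus>\<^bsub>?S\<^esub> (y \<oplus>\<^bsub>?S\<^esub> z)"
      by (auto elim!: locE simp: frac_add W m_ac a_ac l_distr r_distr)
  next
    fix x assume "x \<in> carrier ?S"
    then obtain a w where x: "a \<in> carrier R" "w \<in> W" "x = loc_frac R W a w" by (rule locE)
    then show "\<zero>\<^bsub>?S\<^esub> \<oplus>\<^bsub>?S\<^esub> x = x" by (simp add: frac_zero frac_add W)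
    have "loc_frac R W (\<ominus> a) w \<oplus>\<^bsub>?S\<^esub> x = loc_frac R W (\<ominus> a \<otimes> w \<oplus> a \<otimes> w) (w \<otimes> w)"
      using x by (simp add: frac_add)
    also have "\<dots> = \<zero>\<^bsub>?S\<^esub>"
      unfolding frac_zero using x W[OF x(2)] by (intro frac_eqI[of _ _ _ _ \<one>]) (auto simp: l_minus l_neg)
    finally show "\<exists>y\<in>carrier ?S. y \<oplus>\<^bsub>?S\<^esub> x = \<zero>\<^bsub>?S\<^esub>"
      using x by blast
  qed
  show "Group.comm_monoid ?S"
  proof (rule comm_monoidI)
    show "\<one>\<^bsub>?S\<^esub> \<in> carrier ?S" by (auto simp: frac_one)
  qed (auto elim!: locE simp: frac_mult frac_one W m_ac)
  fix x y z assume "x \<in> carrier ?S" "y \<in> carrier ?S" "z \<in> carrier ?S"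
  then obtain a w b u c v where car: "a \<in> carrier R" "w \<in> W" "b \<in> carrier R" "u \<in> W"
      "c \<in> carrier R" "v \<in> W"
    and eq: "x = loc_frac R W a w" "y = loc_frac R W b u" "z = loc_frac R W c v"
    by (auto elim!: locE)
  note cc = car W[OF car(2)] W[OF car(4)] W[OF car(6)]
  show "(x \<oplus>\<^bsub>?S\<^esub> y) \<otimes>\<^bsub>?S\<^esub> z = x \<otimes>\<^bsub>?S\<^esub> z \<oplus>\<^bsub>?S\<^esub> y \<otimes>\<^bsub>?S\<^esub> z"
    unfolding eq using cc
    by (simp add: frac_mult frac_add) (intro frac_eqI[of _ _ _ _ \<one>]; simp add: m_ac l_distr r_distr)
qed

lemma homD:
  assumes "\<phi> \<in> carrier (cartier_piece R p e)"
  shows "x \<in> carrier R \<Longrightarrow> \<phi> x \<in> carrier R"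
    and "x \<in> carrier R \<Longrightarrow> y \<in> carrier R \<Longrightarrow> \<phi> (x \<oplus> y) = \<phi> x \<oplus> \<phi> y"
    and "r \<in> carrier R \<Longrightarrow> x \<in> carrier R \<Longrightarrow> \<phi> (r [^] (p ^ e) \<otimes> x) = r \<otimes> \<phi> x"
  using assms by (auto simp: cartier_piece_def module_homs_def frob_module_def self_module_def)

lemma pow_pred: "q > 0 \<Longrightarrow> u \<in> carrier R \<Longrightarrow> u [^] q = u \<otimes> u [^] (q - 1 :: nat)"
  by (cases q) (auto simp: m_comm)

lemma loc_hom_frac:
  assumes "p > 0" "\<phi> \<in> carrier (cartier_piece R p e)" "r \<in> carrier R" "w \<in> W" "s \<in> carrier R" "u \<in> W"
  shows "loc_hom R W p e r w \<phi> (loc_frac R W s u)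
    = loc_frac R W (r \<otimes> \<phi> (s \<otimes> u [^] (p ^ e - 1))) (w \<otimes> u)"
proof -
  let ?q = "p ^ e"
  have q: "?q > 0" using assms by simp
  note hom = homD[OF assms(2)]
  have "loc_frac R W (r \<otimes> \<phi> (s' \<otimes> u' [^] (?q - 1))) (w \<otimes> u')
      = loc_frac R W (r \<otimes> \<phi> (s \<otimes> u [^] (?q - 1))) (w \<otimes> u)" if "(s', u') \<in> loc_frac R W s u" for s' u'
  proof -
    from mem_frac[OF that] obtain t where c: "s' \<in> carrier R" "u' \<in> W" "t \<in> W"
      and eq: "t \<otimes> (s' \<otimes> u) = t \<otimes> (s \<otimes> u')" using frac_eq_iff by auto
    note cc = c assms W_carrier[OF c(2)] W_carrier[OF c(3)] W_carrier[OF assms(4)]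
      W_carrier[OF assms(6)] hom
    let ?v = "u [^] (?q - 1)" and ?v' = "u' [^] (?q - 1)" and ?t = "t [^] (?q - 1)"
    have "(t \<otimes> u) \<otimes> \<phi> (s' \<otimes> ?v') = \<phi> ((t \<otimes> u) [^] ?q \<otimes> (s' \<otimes> ?v'))"
      using cc by (simp add: hom(3))
    also have "(t \<otimes> u) [^] ?q \<otimes> (s' \<otimes> ?v') = ?t \<otimes> ?v \<otimes> ?v' \<otimes> (t \<otimes> (s' \<otimes> u))"
      using cc by (simp add: nat_pow_distrib pow_pred[OF q] m_ac)
    also have "\<dots> = (t \<otimes> u') [^] ?q \<otimes> (s \<otimes> ?v)"
      unfolding eq using cc by (simp add: nat_pow_distrib pow_pred[OF q] m_ac)
    also have "\<phi> \<dots> = (t \<otimes> u') \<otimes> \<phi> (s \<otimes> ?v)"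
      using cc by (simp add: hom(3))
    finally have *: "(t \<otimes> u) \<otimes> \<phi> (s' \<otimes> ?v') = (t \<otimes> u') \<otimes> \<phi> (s \<otimes> ?v)" .
    have "t \<otimes> ((r \<otimes> \<phi> (s' \<otimes> ?v')) \<otimes> (w \<otimes> u)) = (r \<otimes> w) \<otimes> ((t \<otimes> u) \<otimes> \<phi> (s' \<otimes> ?v'))"
      using cc by (simp add: m_ac)
    also have "\<dots> = t \<otimes> ((r \<otimes> \<phi> (s \<otimes> ?v)) \<otimes> (w \<otimes> u'))"
      unfolding * using cc by (simp add: m_ac)
    finally show ?thesis using cc by (intro frac_eqI[of _ _ _ _ t]) auto
  qed
  then show ?thesis
    unfolding loc_hom_def using assms by (simp add: UN_frac)
qed

lemma frac_pow:
  "a \<in> carrier R \<Longrightarrow> w \<in> W \<Longrightarrow>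
    loc_frac R W a w [^]\<^bsub>localization R W\<^esub> (n::nat) = loc_frac R W (a [^] n) (w [^] n) \<and> w [^] n \<in> W"
  by (induction n) (auto simp: frac_one frac_mult)

lemma loc_hom_closed:
  assumes p: "p > 0" and phi: "\<phi> \<in> carrier (cartier_piece R p e)" and rw: "r \<in> carrier R" "w \<in> W"
  shows "loc_hom R W p e r w \<phi> \<in> carrier (cartier_piece (localization R W) p e)"
proof -
  let ?q = "p ^ e" and ?S = "localization R W" and ?f = "loc_hom R W p e r w \<phi>"
  have q: "?q > 0" using p by simp
  note hom = homD[OF phi] and fr = loc_hom_frac[OF p phi rw]
  have car: "?f U \<in> carrier ?S" if "U \<in> carrier ?S" for U
    using that by (elim locE) (auto simp: fr rw hom W_carrier)
  have ad: "?f (U \<oplus>\<^bsub>?S\<^esub> V) = ?f U \<oplus>\<^bsub>?S\<^esub> ?f V" if "U \<in> carrier ?S" "V \<in> carrier ?S" for U V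
  proof -
    from that obtain a v b u where c: "a \<in> carrier R" "v \<in> W" "b \<in> carrier R" "u \<in> W"
      and xyeq: "U = loc_frac R W a v" "V = loc_frac R W b u" by (auto elim!: locE)
    note cc = c rw W_carrier[OF c(2)] W_carrier[OF c(4)] W_carrier[OF rw(2)]
    have "(a \<otimes> u \<oplus> b \<otimes> v) \<otimes> (v \<otimes> u) [^] (?q - 1)
        = u [^] ?q \<otimes> (a \<otimes> v [^] (?q - 1)) \<oplus> v [^] ?q \<otimes> (b \<otimes> u [^] (?q - 1))"
      using cc by (simp add: nat_pow_distrib pow_pred[OF q] m_ac l_distr r_distr)
    then have "\<phi> ((a \<otimes> u \<oplus> b \<otimes> v) \<otimes> (v \<otimes> u) [^] (?q - 1))
        = u \<otimes> \<phi> (a \<otimes> v [^] (?q - 1)) \<oplus> v \<otimes> \<phi> (b \<otimes> u [^] (?q - 1))"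
      using cc by (simp add: hom)
    then show ?thesis
      unfolding xyeq using cc
      by (simp add: fr frac_add hom) (intro frac_eqI[of _ _ _ _ \<one>]; simp add: hom m_ac l_distr r_distr)
  qed
  have sm: "?f (A [^]\<^bsub>?S\<^esub> ?q \<otimes>\<^bsub>?S\<^esub> U) = A \<otimes>\<^bsub>?S\<^esub> ?f U" if "A \<in> carrier ?S" "U \<in> carrier ?S" for A U
  proof -
    from that obtain a v b u where c: "a \<in> carrier R" "v \<in> W" "b \<in> carrier R" "u \<in> W"
      and xyeq: "A = loc_frac R W a v" "U = loc_frac R W b u" by (auto elim!: locE)
    let ?z = "a \<otimes> v [^] (?q - 1)"
    have vq: "v [^] ?q \<in> W" using frac_pow[OF c(1,2)] by blast
    note cc = c rw W_carrier[OF c(2)] W_carrier[OF c(4)] W_carrier[OF rw(2)] vq W_carrier[OF vq]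
    have v: "v [^] ?q = v \<otimes> v [^] (?q - 1)"
      by (rule pow_pred[OF q]) (use cc in simp)
    have "(a [^] ?q \<otimes> b) \<otimes> (v [^] ?q \<otimes> u) [^] (?q - 1)
        = ?z [^] ?q \<otimes> (b \<otimes> u [^] (?q - 1))"
      using cc by (simp add: nat_pow_distrib nat_pow_pow m_ac mult.commute)
    then have num: "\<phi> ((a [^] ?q \<otimes> b) \<otimes> (v [^] ?q \<otimes> u) [^] (?q - 1))
        = ?z \<otimes> \<phi> (b \<otimes> u [^] (?q - 1))"
      using cc by (simp add: hom)
    have "?f (A [^]\<^bsub>?S\<^esub> ?q \<otimes>\<^bsub>?S\<^esub> U)
        = loc_frac R W (r \<otimes> (?z \<otimes> \<phi> (b \<otimes> u [^] (?q - 1)))) (w \<otimes> (v [^] ?q \<otimes> u))"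
      unfolding xyeq num[symmetric] using cc frac_pow[OF c(1,2), of ?q]
      by (simp add: fr frac_mult)
    also have "\<dots> = loc_frac R W (a \<otimes> (r \<otimes> \<phi> (b \<otimes> u [^] (?q - 1)))) (v \<otimes> (w \<otimes> u))"
    proof (rule frac_eqI[of _ _ _ _ \<one>])
      show "\<one> \<otimes> (r \<otimes> (?z \<otimes> \<phi> (b \<otimes> u [^] (?q - 1))) \<otimes> (v \<otimes> (w \<otimes> u)))
          = \<one> \<otimes> (a \<otimes> (r \<otimes> \<phi> (b \<otimes> u [^] (?q - 1))) \<otimes> (w \<otimes> (v [^] ?q \<otimes> u)))"
        unfolding v using cc by (simp add: hom m_ac)
    qed (use cc in \<open>auto simp: hom\<close>)
    also have "\<dots> = A \<otimes>\<^bsub>?S\<^esub> ?f U"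
      unfolding xyeq using cc by (simp add: fr frac_mult hom)
    finally show ?thesis .
  qed
  have "?f \<in> extensional (carrier ?S)" by (simp add: loc_hom_def)
  with car ad sm show ?thesis
    by (auto simp: cartier_piece_def module_homs_def frob_module_def self_module_def PiE_def)
qed

end

end

theory Submission
  imports Defs
begin

text \<open>
  Everything reduces to numerators. Since \<open>R\<close> is Noetherian, an element that kills a nonzero element
  of \<open>R/J\<close> lies in an associated prime of \<open>J\<close>; hence the elements of \<open>W\<close> are nonzerodivisors on
  \<open>R/J\<close>, that is, \<open>J\<close> is saturated: \<open>t a \<in> J\<close> with \<open>t \<in> W\<close> forces \<open>a \<in> J\<close>
  (\<open>nonzerodivisor_mod_if_avoids_Ass\<close>). For a saturated ideal \<open>I\<close>, a fraction \<open>a/w\<close> lies in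
  \<open>I W\<^sup>-\<^sup>1R\<close> exactly when \<open>a \<in> I\<close> (\<open>frac_mem_extension_iff\<close>).

  Let \<open>q = p\<^sup>e\<close>. The identity \<open>\<phi>(t\<^sup>q a) = t \<phi>(a)\<close> has two uses. As \<open>\<D>\<close> is closed under
  precomposition with multiplications, it shows that the Cartier core of the saturated ideal \<open>J\<close> is
  again a saturated ideal (\<open>core_ideal\<close>, \<open>core_saturated\<close>). It also gives the central equivalence
  \<open>frac_mem_core_iff\<close>: the fraction \<open>s/u\<close> is in the core of \<open>J W\<^sup>-\<^sup>1R\<close> if and only if
  \<open>s\<close> is in the core of \<open>J\<close>. Indeed, \<open>r/w \<otimes> \<phi>\<close> sends \<open>s/u\<close> to
  \<open>r \<phi>(s u\<^sup>q\<^sup>-\<^sup>1) / (w u)\<close>, which lies in \<open>J W\<^sup>-\<^sup>1R\<close> for all \<open>r/w\<close> just when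
  \<open>\<phi>(s u\<^sup>q\<^sup>-\<^sup>1) \<in> J\<close>; and this holds for all \<open>\<phi>\<close> just when \<open>\<phi>(s) \<in> J\<close> for all \<open>\<phi>\<close>,
  because one may pass from \<open>s\<close> to \<open>s u\<^sup>q\<^sup>-\<^sup>1\<close> and from there to \<open>s u\<^sup>q\<close>, whose image is
  \<open>u \<phi>(s)\<close>.

  Both equalities follow: \<open>s/u\<close> belongs to \<open>C(J) W\<^sup>-\<^sup>1R\<close>, and to the core of \<open>J W\<^sup>-\<^sup>1R\<close>,
  under the same condition \<open>s \<in> C(J)\<close>.
\<close>

section \<open>Nonzerodivisors modulo an ideal\<close>

text \<open>The annihilator of the class of \<open>y\<close> in \<open>R/J\<close>.\<close>

definition colon :: "('a, 'm) ring_scheme \<Rightarrow> 'a set \<Rightarrow> 'a \<Rightarrow> 'a set" where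
  "colon R J y = {r \<in> carrier R. r \<otimes>\<^bsub>R\<^esub> y \<in> J}"

lemma (in cring) colon_ideal:
  assumes "ideal J R" and y: "y \<in> carrier R"
  shows "ideal (colon R J y) R"
proof -
  interpret J: ideal J R by fact
  show ?thesis
  proof (rule idealI[OF ring_axioms])
    show "subgroup (colon R J y) (add_monoid R)"
    proof (rule add.subgroupI)
      show "colon R J y \<noteq> {}"
        unfolding colon_def using y by (auto intro!: exI[of _ \<zero>])
      show "\<ominus> a \<in> colon R J y" if "a \<in> colon R J y" for a
        using that y by (auto simp: colon_def l_minus)
    qed (auto simp: colon_def l_distr y)
    show l: "x \<otimes> a \<in> colon R J y" if "a \<in> colon R J y" "x \<in> carrier R" for a x
      using that y by (auto simp: colon_def m_assoc J.I_l_closed)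
    show "a \<otimes> x \<in> colon R J y" if "a \<in> colon R J y" "x \<in> carrier R" for a x
      using l[OF that] that m_comm[of a x] by (auto simp: colon_def)
  qed
qed

lemma (in cring) prime_colon_in_Ass:
  assumes "ideal J R" and y: "y \<in> carrier R" and prime: "primeideal (colon R J y) R"
  shows "colon R J y \<in> Ass R J"
proof -
  interpret J: ideal J R by fact
  have "(J +> r) \<otimes>\<^bsub>R Quot J\<^esub> (J +> y) = \<zero>\<^bsub>R Quot J\<^esub> \<longleftrightarrow> r \<otimes> y \<in> J"
    if r: "r \<in> carrier R" for r
  proof -
    have "(J +> r) \<otimes>\<^bsub>R Quot J\<^esub> (J +> y) = J +> (r \<otimes> y)"
      by (simp add: FactRing_def J.rcoset_mult_add r y)
    moreover have "J +> (r \<otimes> y) = J \<longleftrightarrow> r \<otimes> y \<in> J"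
      using J.a_rcos_const[of "r \<otimes> y"] J.rcos_const_imp_mem[of "r \<otimes> y"] r y by auto
    ultimately show ?thesis by (simp add: FactRing_def)
  qed
  moreover have "J +> y \<in> carrier (R Quot J)"
    using y by (auto simp: FactRing_def A_RCOSETS_def')
  ultimately show ?thesis
    using prime unfolding Ass_def colon_def by blast
qed

text \<open>Among the annihilators of nonzero elements of \<open>R/J\<close> that contain a given zerodivisor, a
  maximal one exists by the Noetherian hypothesis, and it is an associated prime: if \<open>a b\<close> kills
  \<open>y\<close> and \<open>b\<close> does not, then the annihilator of \<open>b y\<close> contains that of \<open>y\<close>, so by maximality
  both agree and \<open>a\<close> kills \<open>y\<close>.\<close>

lemma (in cring) nonzerodivisor_mod_if_avoids_Ass:
  assumes noeth: "noetherian_ring R" and J: "ideal J R"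
    and w: "w \<in> carrier R" "\<And>P. P \<in> Ass R J \<Longrightarrow> w \<notin> P"
    and x: "x \<in> carrier R" "w \<otimes> x \<in> J"
  shows "x \<in> J"
proof (rule ccontr)
  assume "x \<notin> J"
  interpret J: ideal J R by fact
  define S where "S = {colon R J y | y. y \<in> carrier R \<and> y \<notin> J \<and> w \<otimes> y \<in> J}"
  have S_ideal: "S \<subseteq> {I. ideal I R}"
    by (auto simp: S_def colon_ideal J)
  have "\<exists>M\<in>S. \<forall>N\<in>S. M \<subseteq> N \<longrightarrow> N = M"
  proof (rule subset_Zorn)
    fix C assume C: "subset.chain S C"
    show "\<exists>U\<in>S. \<forall>N\<in>C. N \<subseteq> U"
    proof (cases "C = {}")
      case True
      then show ?thesis using x \<open>x \<notin> J\<close> by (auto simp: S_def)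
    next
      case False
      have "subset.chain {I. ideal I R} C"
        using C S_ideal by (auto simp: subset.chain_def)
      then have "\<Union>C \<in> C"
        by (rule noetherian_ring.ideal_chain_is_trivial[OF noeth False])
      then show ?thesis using C by (auto simp: subset.chain_def)
    qed
  qed
  then obtain y where y: "y \<in> carrier R" "y \<notin> J" "w \<otimes> y \<in> J"
    and max: "\<And>N. N \<in> S \<Longrightarrow> colon R J y \<subseteq> N \<Longrightarrow> N = colon R J y"
    by (auto simp: S_def)
  have "primeideal (colon R J y) R"
  proof (rule primeidealI)
    show "ideal (colon R J y) R" using J y by (simp add: colon_ideal)
    show "cring R" by (rule is_cring)
    have "\<one> \<notin> colon R J y" using y by (simp add: colon_def)
    then show "carrier R \<noteq> colon R J y" by blast
    fix a b assume ab: "a \<in> carrier R" "b \<in> carrier R" "a \<otimes> b \<in> colon R J y"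
    show "a \<in> colon R J y \<or> b \<in> colon R J y"
    proof (rule disjCI)
      assume "b \<notin> colon R J y"
      then have by_notin: "b \<otimes> y \<notin> J" using ab by (simp add: colon_def)
      have swap: "r \<otimes> (b \<otimes> y) \<in> J" if "r \<in> carrier R" "r \<otimes> y \<in> J" for r
        using J.I_l_closed[OF that(2) ab(2)] that(1) ab y by (simp add: m_lcomm)
      have "colon R J (b \<otimes> y) \<in> S"
        using ab y by_notin swap[OF w(1) y(3)] by (auto simp: S_def)
      moreover have "colon R J y \<subseteq> colon R J (b \<otimes> y)"
        using swap by (auto simp: colon_def)
      ultimately have "colon R J (b \<otimes> y) = colon R J y" by (rule max)
      moreover have "a \<in> colon R J (b \<otimes> y)"
        using ab y by (simp add: colon_def m_assoc)
      ultimately show "a \<in> colon R J y" by simp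
    qed
  qed
  then have "colon R J y \<in> Ass R J" using J y(1) prime_colon_in_Ass by blast
  moreover have "w \<in> colon R J y" using w(1) y(3) by (simp add: colon_def)
  ultimately show False using w(2) by blast
qed

section \<open>Extension of ideals to the localization\<close>

context cring_mult_set
begin

definition saturated :: "'a set \<Rightarrow> bool" where
  "saturated I \<longleftrightarrow> (\<forall>t\<in>W. \<forall>a\<in>carrier R. t \<otimes> a \<in> I \<longrightarrow> a \<in> I)"

lemma saturatedD: "saturated I \<Longrightarrow> t \<otimes> a \<in> I \<Longrightarrow> t \<in> W \<Longrightarrow> a \<in> carrier R \<Longrightarrow> a \<in> I"
  by (auto simp: saturated_def)

lemma frac_minus:
  assumes "a \<in> carrier R" "w \<in> W"
  shows "\<ominus>\<^bsub>localization R W\<^esub> loc_frac R W a w = loc_frac R W (\<ominus> a) w"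
proof -
  interpret S: cring "localization R W" by (rule localization_cring)
  have "loc_frac R W (\<ominus> a) w \<oplus>\<^bsub>localization R W\<^esub> loc_frac R W a w = \<zero>\<^bsub>localization R W\<^esub>"
    using assms W_carrier[OF assms(2)] unfolding frac_zero
    by (simp add: frac_add) (intro frac_eqI[of _ _ _ _ \<one>]; simp add: l_minus l_neg)
  then show ?thesis
    using assms by (intro S.minus_equality) auto
qed

lemma fractions_ideal:
  assumes "ideal I R"
  shows "ideal {loc_frac R W a w | a w. a \<in> I \<and> w \<in> W} (localization R W)" (is "ideal ?K ?S")
proof -
  interpret I: ideal I R by fact
  interpret S: cring ?S by (rule localization_cring)
  note I_carrier = I.a_Hcarr
  have mult: "x \<otimes>\<^bsub>?S\<^esub> a \<in> ?K" if a: "a \<in> ?K" and x: "x \<in> carrier ?S" for a x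
  proof -
    obtain b u where bu: "a = loc_frac R W b u" "b \<in> I" "u \<in> W"
      using a by auto
    obtain c v where cv: "c \<in> carrier R" "v \<in> W" "x = loc_frac R W c v"
      using x by (rule locE)
    have "x \<otimes>\<^bsub>?S\<^esub> a = loc_frac R W (c \<otimes> b) (v \<otimes> u)"
      using bu cv by (simp add: frac_mult I_carrier)
    moreover have "c \<otimes> b \<in> I" "v \<otimes> u \<in> W"
      using bu cv by (auto intro: I.I_l_closed)
    ultimately show ?thesis by blast
  qed
  have K_carrier: "?K \<subseteq> carrier ?S" using I_carrier by auto
  show ?thesis
  proof (rule idealI[OF S.ring_axioms])
    show "subgroup ?K (add_monoid ?S)"
    proof (rule S.add.subgroupI)
      show "?K \<subseteq> carrier ?S" by (rule K_carrier)
      show "?K \<noteq> {}" using I.zero_closed one_closed by blast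
      show "\<ominus>\<^bsub>?S\<^esub> x \<in> ?K" if "x \<in> ?K" for x
      proof -
        from that obtain a w where "x = loc_frac R W a w" "a \<in> I" "w \<in> W" by auto
        then have "\<ominus>\<^bsub>?S\<^esub> x = loc_frac R W (\<ominus> a) w" "\<ominus> a \<in> I" "w \<in> W"
          by (auto simp: frac_minus I_carrier)
        then show ?thesis by blast
      qed
      show "x \<oplus>\<^bsub>?S\<^esub> y \<in> ?K" if xy: "x \<in> ?K" "y \<in> ?K" for x y
      proof -
        obtain a w b u where ab: "x = loc_frac R W a w" "a \<in> I" "w \<in> W"
          "y = loc_frac R W b u" "b \<in> I" "u \<in> W"
          using xy by auto
        have "x \<oplus>\<^bsub>?S\<^esub> y = loc_frac R W (a \<otimes> u \<oplus> b \<otimes> w) (w \<otimes> u)"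
          using ab by (simp add: frac_add I_carrier)
        moreover have "a \<otimes> u \<oplus> b \<otimes> w \<in> I" "w \<otimes> u \<in> W"
          using ab by (auto intro: I.a_closed I.I_r_closed W_carrier)
        ultimately show ?thesis by blast
      qed
    qed
    show "a \<otimes>\<^bsub>?S\<^esub> x \<in> ?K" if "a \<in> ?K" "x \<in> carrier ?S" for a x
    proof -
      have "a \<in> carrier ?S" using that(1) K_carrier by (rule subsetD[rotated])
      then show ?thesis using mult[OF that] that(2) by (simp only: S.m_comm)
    qed
  qed (rule mult)
qed

lemma extension_ideal:
  assumes "ideal I R"
  shows "ideal (loc_extension R W I) (localization R W)"
proof -
  interpret I: ideal I R by fact
  interpret S: cring "localization R W" by (rule localization_cring)
  show ?thesis
    unfolding loc_extension_def by (rule S.genideal_ideal) (auto simp: loc_map_def I.a_Hcarr)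
qed

lemma extension_eq_fractions:
  assumes "ideal I R"
  shows "loc_extension R W I = {loc_frac R W a w | a w. a \<in> I \<and> w \<in> W}" (is "_ = ?K")
proof
  interpret I: ideal I R by fact
  interpret S: cring "localization R W" by (rule localization_cring)
  interpret E: ideal "loc_extension R W I" "localization R W"
    by (rule extension_ideal[OF assms])
  show "loc_extension R W I \<subseteq> ?K"
    unfolding loc_extension_def
  proof (rule S.genideal_minimal)
    show "ideal ?K (localization R W)" by (rule fractions_ideal[OF assms])
    show "loc_map R W ` I \<subseteq> ?K" unfolding loc_map_def using one_closed by blast
  qed
  show "?K \<subseteq> loc_extension R W I"
  proof clarify
    fix a w assume aw: "a \<in> I" "w \<in> W"
    have "loc_map R W ` I \<subseteq> loc_extension R W I"
      unfolding loc_extension_def by (rule S.genideal_self) (auto simp: loc_map_def I.a_Hcarr)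
    then have "loc_frac R W a \<one> \<in> loc_extension R W I"
      using aw by (auto simp: loc_map_def)
    then have "loc_frac R W a \<one> \<otimes>\<^bsub>localization R W\<^esub> loc_frac R W \<one> w \<in> loc_extension R W I"
      using aw by (intro E.I_r_closed) auto
    then show "loc_frac R W a w \<in> loc_extension R W I"
      using aw by (simp add: frac_mult I.a_Hcarr W_carrier)
  qed
qed

lemma frac_mem_extension_iff:
  assumes I: "ideal I R" "saturated I" and aw: "a \<in> carrier R" "w \<in> W"
  shows "loc_frac R W a w \<in> loc_extension R W I \<longleftrightarrow> a \<in> I"
proof
  interpret I: ideal I R by fact
  assume "loc_frac R W a w \<in> loc_extension R W I"
  then obtain b u where b: "b \<in> I" and u: "u \<in> W" and eq: "loc_frac R W a w = loc_frac R W b u"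
    unfolding extension_eq_fractions[OF I(1)] by auto
  then obtain t where t: "t \<in> W" and cross: "t \<otimes> (a \<otimes> u) = t \<otimes> (b \<otimes> w)"
    using frac_eq_iff[OF aw I.a_Hcarr[OF b] u] by blast
  note car = aw u t W_carrier[OF aw(2)] W_carrier[OF u] W_carrier[OF t] I.a_Hcarr[OF b]
  have "(t \<otimes> u) \<otimes> a = (t \<otimes> w) \<otimes> b"
    using cross car by (simp add: m_ac)
  also have "\<dots> \<in> I" using car b by (intro I.I_l_closed) auto
  finally show "a \<in> I" by (rule saturatedD[OF I(2)]) (use car in auto)
qed (use aw in \<open>auto simp: extension_eq_fractions[OF I(1)]\<close>)

end

section \<open>Groups of \<open>p\<close>-inverse linear maps\<close>

lemma (in cring) frob_homD:
  assumes "f \<in> carrier (cartier_piece R p e)"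
  shows "f \<in> extensional (carrier R)"
    and "x \<in> carrier R \<Longrightarrow> f x \<in> carrier R"
    and "x \<in> carrier R \<Longrightarrow> y \<in> carrier R \<Longrightarrow> f (x \<oplus> y) = f x \<oplus> f y"
    and "r \<in> carrier R \<Longrightarrow> x \<in> carrier R \<Longrightarrow> f (r [^] (p ^ e) \<otimes> x) = r \<otimes> f x"
  using assms
  by (auto simp: cartier_piece_def module_homs_def frob_module_def self_module_def PiE_def)

lemma (in cring) frob_homI:
  assumes "f \<in> extensional (carrier R)"
    and "\<And>x. x \<in> carrier R \<Longrightarrow> f x \<in> carrier R"
    and "\<And>x y. x \<in> carrier R \<Longrightarrow> y \<in> carrier R \<Longrightarrow> f (x \<oplus> y) = f x \<oplus> f y"
    and "\<And>r x. r \<in> carrier R \<Longrightarrow> x \<in> carrier R \<Longrightarrow> f (r [^] (p ^ e) \<otimes> x) = r \<otimes> f x"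
  shows "f \<in> carrier (cartier_piece R p e)"
  using assms
  by (auto simp: cartier_piece_def module_homs_def frob_module_def self_module_def PiE_def)

lemma cartier_piece_mult:
  "x \<in> carrier R \<Longrightarrow> (f \<otimes>\<^bsub>cartier_piece R p e\<^esub> g) x = f x \<oplus>\<^bsub>R\<^esub> g x"
  by (simp add: cartier_piece_def)

lemma cartier_piece_one: "x \<in> carrier R \<Longrightarrow> \<one>\<^bsub>cartier_piece R p e\<^esub> x = \<zero>\<^bsub>R\<^esub>"
  by (simp add: cartier_piece_def)

lemma cartier_piece_extensional:
  "f \<otimes>\<^bsub>cartier_piece R p e\<^esub> g \<in> extensional (carrier R)"
  "\<one>\<^bsub>cartier_piece R p e\<^esub> \<in> extensional (carrier R)"
  by (simp_all add: cartier_piece_def)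

lemma (in cring) cartier_piece_group: "group (cartier_piece R p e)"
proof (rule groupI)
  let ?G = "cartier_piece R p e"
  note simps = cartier_piece_mult cartier_piece_one cartier_piece_extensional
  show closed: "f \<otimes>\<^bsub>?G\<^esub> g \<in> carrier ?G" if "f \<in> carrier ?G" "g \<in> carrier ?G" for f g
    using frob_homD[OF that(1)] frob_homD[OF that(2)]
    by (intro frob_homI) (simp_all add: simps a_ac r_distr)
  show one: "\<one>\<^bsub>?G\<^esub> \<in> carrier ?G"
    by (intro frob_homI) (simp_all add: simps)
  fix f assume f: "f \<in> carrier ?G"
  note fD = frob_homD[OF f]
  show "\<one>\<^bsub>?G\<^esub> \<otimes>\<^bsub>?G\<^esub> f = f"
    by (rule extensionalityI[of _ "carrier R"]) (simp_all add: simps fD)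
  let ?g = "\<lambda>x\<in>carrier R. \<ominus> f x"
  have "?g \<in> carrier ?G"
    by (intro frob_homI) (simp_all add: fD minus_add r_minus)
  moreover have "?g \<otimes>\<^bsub>?G\<^esub> f = \<one>\<^bsub>?G\<^esub>"
    by (rule extensionalityI[of _ "carrier R"]) (simp_all add: simps fD l_neg)
  ultimately show "\<exists>g\<in>carrier ?G. g \<otimes>\<^bsub>?G\<^esub> f = \<one>\<^bsub>?G\<^esub>" by blast
  fix g h assume "g \<in> carrier ?G" "h \<in> carrier ?G"
  then show "f \<otimes>\<^bsub>?G\<^esub> g \<otimes>\<^bsub>?G\<^esub> h = f \<otimes>\<^bsub>?G\<^esub> (g \<otimes>\<^bsub>?G\<^esub> h)"
    by (intro extensionalityI[of _ "carrier R"])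
       (simp_all add: simps fD frob_homD[of g] frob_homD[of h] a_assoc)
qed

text \<open>The maps that send \<open>x\<close> into a fixed ideal form a subgroup, so this property needs to be tested
  on generators only. It is applied to the sums of pure tensors in \<open>W\<^sup>-\<^sup>1R \<otimes> \<D>\<^sub>e\<close>.\<close>

lemma (in cring) generate_maps_into_ideal_iff:
  assumes K: "ideal K R" and x: "x \<in> carrier R" and H: "H \<subseteq> carrier (cartier_piece R p e)"
  shows "(\<forall>f\<in>generate (cartier_piece R p e) H. f x \<in> K) \<longleftrightarrow> (\<forall>f\<in>H. f x \<in> K)"
proof
  let ?G = "cartier_piece R p e"
  interpret G: group ?G by (rule cartier_piece_group)
  interpret K: ideal K R by fact
  assume H_K: "\<forall>f\<in>H. f x \<in> K"
  let ?B = "{f \<in> carrier ?G. f x \<in> K}"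
  have "subgroup ?B ?G"
  proof (rule G.subgroupI)
    show "?B \<noteq> {}" using cartier_piece_one[OF x, of p e] by fastforce
    show "inv\<^bsub>?G\<^esub> f \<in> ?B" if f: "f \<in> ?B" for f
    proof -
      have inv: "inv\<^bsub>?G\<^esub> f \<in> carrier ?G" using f by simp
      have "(inv\<^bsub>?G\<^esub> f \<otimes>\<^bsub>?G\<^esub> f) x = \<zero>"
        using f by (simp add: cartier_piece_one x)
      then have "(inv\<^bsub>?G\<^esub> f) x \<oplus> f x = \<zero>"
        by (simp add: cartier_piece_mult x)
      then have "(inv\<^bsub>?G\<^esub> f) x = \<ominus> f x"
        using f frob_homD(2)[OF inv x] frob_homD(2)[of f p e x] x
        by (metis (no_types, lifting) mem_Collect_eq minus_equality)
      then show ?thesis using f inv by simp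
    qed
  qed (auto simp: cartier_piece_mult x)
  then have "generate ?G H \<subseteq> ?B"
    by (rule G.generate_subgroup_incl[rotated]) (use H H_K in auto)
  then show "\<forall>f\<in>generate ?G H. f x \<in> K" by blast
qed (auto intro: generate.incl)

section \<open>Cartier cores and localization\<close>

locale cartier_localization = cring_mult_set R W + cartier_subalgebra R p D
  for R (structure) and W p D +
  assumes p_pos: "p > 0"
begin

lemma D_hom: "\<phi> \<in> D e \<Longrightarrow> \<phi> \<in> carrier (cartier_piece R p e)"
  using subgroup.subset[OF piece_subgroup] by blast

lemma precompose_mult:
  assumes phi: "\<phi> \<in> D e" and r: "r \<in> carrier R"
  shows "\<exists>\<psi>\<in>D e. \<forall>x\<in>carrier R. \<psi> x = \<phi> (r \<otimes> x)"
proof -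
  let ?m = "\<lambda>x\<in>carrier R. r \<otimes> x"
  have "?m \<in> carrier (cartier_piece R p 0)"
    using r by (intro frob_homI) (simp_all add: r_distr m_lcomm)
  then have "compose (carrier R) \<phi> ?m \<in> D (e + 0)"
    unfolding degree_zero[symmetric] by (rule prod_closed[OF phi])
  then show ?thesis by (intro bexI[of _ "compose (carrier R) \<phi> ?m"]) (auto simp: compose_def)
qed

lemma core_mult_closed:
  assumes "s \<in> cartier_core R D J" and r: "r \<in> carrier R"
  shows "r \<otimes> s \<in> cartier_core R D J"
  unfolding cartier_core_def
proof (intro CollectI conjI allI impI ballI)
  have s: "s \<in> carrier R" using assms by (simp add: cartier_core_def)
  then show "r \<otimes> s \<in> carrier R" using r by simp
  fix e :: nat and \<phi> assume e: "0 < e" and "\<phi> \<in> D e"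
  then obtain \<psi> where "\<psi> \<in> D e" "\<psi> s = \<phi> (r \<otimes> s)"
    using precompose_mult[OF _ r] s by blast
  then show "\<phi> (r \<otimes> s) \<in> J" using assms(1) e unfolding cartier_core_def
    by (metis (no_types, lifting) mem_Collect_eq)
qed

lemma core_ideal:
  assumes "ideal J R"
  shows "ideal (cartier_core R D J) R"
proof -
  interpret J: ideal J R by fact
  let ?C = "cartier_core R D J"
  have C_carrier: "?C \<subseteq> carrier R" by (auto simp: cartier_core_def)
  show ?thesis
  proof (rule idealI[OF ring_axioms])
    show "subgroup ?C (add_monoid R)"
    proof (rule add.subgroupI)
      show "?C \<subseteq> carrier R" by (rule C_carrier)
      have "\<phi> \<zero> \<in> J" if "\<phi> \<in> D e" for e \<phi>
      proof -
        have "\<phi> \<zero> \<oplus> \<phi> \<zero> = \<phi> \<zero>"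
          using frob_homD(3)[OF D_hom[OF that], of \<zero> \<zero>] by simp
        then have "\<phi> \<zero> = \<zero>"
          using frob_homD(2)[OF D_hom[OF that], of \<zero>] by (simp add: add.r_cancel_one)
        then show ?thesis by simp
      qed
      then show "?C \<noteq> {}" by (auto simp: cartier_core_def intro!: exI[of _ \<zero>])
      show "\<ominus> a \<in> ?C" if "a \<in> ?C" for a
      proof -
        have "\<ominus> \<one> \<otimes> a \<in> ?C" using that by (intro core_mult_closed) auto
        then show ?thesis using that C_carrier by (auto simp: l_minus subset_iff)
      qed
      show "a \<oplus> b \<in> ?C" if ab: "a \<in> ?C" "b \<in> ?C" for a b
        unfolding cartier_core_def
      proof (intro CollectI conjI allI impI ballI)
        show "a \<oplus> b \<in> carrier R" using ab C_carrier by blast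
        fix e :: nat and \<phi> assume "0 < e" "\<phi> \<in> D e"
        then have "\<phi> a \<in> J" "\<phi> b \<in> J" using ab by (auto simp: cartier_core_def)
        moreover have "\<phi> (a \<oplus> b) = \<phi> a \<oplus> \<phi> b"
          using ab C_carrier by (intro frob_homD(3)[OF D_hom[OF \<open>\<phi> \<in> D e\<close>]]) auto
        ultimately show "\<phi> (a \<oplus> b) \<in> J" by simp
      qed
    qed
    show "x \<otimes> a \<in> ?C" if "a \<in> ?C" "x \<in> carrier R" for a x
      using that by (rule core_mult_closed)
    then show "a \<otimes> x \<in> ?C" if "a \<in> ?C" "x \<in> carrier R" for a x
      using that C_carrier m_comm[of a x] by auto
  qed
qed

text \<open>If \<open>\<phi>(s t\<^sup>q\<^sup>-\<^sup>1) \<in> J\<close> for all \<open>\<phi>\<close> of degree \<open>e\<close>, then also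
  \<open>t \<phi>(s) = \<phi>(t \<cdot> s t\<^sup>q\<^sup>-\<^sup>1) \<in> J\<close>, and \<open>t\<close> can be cancelled.\<close>

lemma cancel_pow_pred:
  assumes J: "saturated J" and s: "s \<in> carrier R" and t: "t \<in> W"
    and maps: "\<And>\<psi>. \<psi> \<in> D e \<Longrightarrow> \<psi> (s \<otimes> t [^] (p ^ e - 1)) \<in> J"
    and phi: "\<phi> \<in> D e"
  shows "\<phi> s \<in> J"
proof -
  have tc: "t \<in> carrier R" using t by (rule W_carrier)
  obtain \<psi> where psi: "\<psi> \<in> D e" and "\<And>x. x \<in> carrier R \<Longrightarrow> \<psi> x = \<phi> (t \<otimes> x)"
    using precompose_mult[OF phi tc] by blast
  then have "\<psi> (s \<otimes> t [^] (p ^ e - 1)) = \<phi> (t [^] (p ^ e) \<otimes> s)"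
    using s tc p_pos by (simp add: pow_pred[of "p ^ e"] m_ac)
  also have "\<dots> = t \<otimes> \<phi> s"
    using s tc by (intro frob_homD(4)[OF D_hom[OF phi]])
  finally have "t \<otimes> \<phi> s \<in> J" using maps[OF psi] by simp
  then show ?thesis
    using J t frob_homD(2)[OF D_hom[OF phi] s] by (elim saturatedD)
qed

lemma core_saturated:
  assumes "saturated J"
  shows "saturated (cartier_core R D J)"
  unfolding saturated_def
proof (intro ballI impI)
  fix t a assume t: "t \<in> W" and a: "a \<in> carrier R" and ta: "t \<otimes> a \<in> cartier_core R D J"
  show "a \<in> cartier_core R D J"
    unfolding cartier_core_def
  proof (intro CollectI conjI allI impI ballI a)
    fix e :: nat and \<phi> assume e: "0 < e" and phi: "\<phi> \<in> D e"
    have tc: "t \<in> carrier R" using t by (rule W_carrier)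
    have "t [^] (p ^ e - 1) \<otimes> (t \<otimes> a) \<in> cartier_core R D J"
      using ta tc by (simp add: core_mult_closed)
    also have "t [^] (p ^ e - 1) \<otimes> (t \<otimes> a) = t [^] (p ^ e) \<otimes> a"
      using tc a p_pos by (simp add: pow_pred[of "p ^ e"] m_ac)
    finally have "\<phi> (t [^] (p ^ e) \<otimes> a) \<in> J" using e phi by (auto simp: cartier_core_def)
    then have "t \<otimes> \<phi> a \<in> J"
      using frob_homD(4)[OF D_hom[OF phi] tc a] by simp
    then show "\<phi> a \<in> J"
      using assms t frob_homD(2)[OF D_hom[OF phi] a] by (elim saturatedD)
  qed
qed

lemma frac_maps_into_extension_iff:
  assumes J: "ideal J R" "saturated J" and s: "s \<in> carrier R" and u: "u \<in> W"
  shows "(\<forall>f\<in>loc_cartier R W p D e. f (loc_frac R W s u) \<in> loc_extension R W J)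
    \<longleftrightarrow> (\<forall>\<phi>\<in>D e. \<phi> (s \<otimes> u [^] (p ^ e - 1)) \<in> J)" (is "?L \<longleftrightarrow> ?R")
proof -
  interpret S: cring "localization R W" by (rule localization_cring)
  interpret J: ideal J R by fact
  let ?x = "s \<otimes> u [^] (p ^ e - 1)"
  let ?H = "{loc_hom R W p e r w \<phi> | r w \<phi>. r \<in> carrier R \<and> w \<in> W \<and> \<phi> \<in> D e}"
  have x: "?x \<in> carrier R" using s u W_carrier by simp
  have val: "loc_hom R W p e r w \<phi> (loc_frac R W s u) \<in> loc_extension R W J \<longleftrightarrow> r \<otimes> \<phi> ?x \<in> J"
    if "r \<in> carrier R" "w \<in> W" "\<phi> \<in> D e" for r w \<phi>
    using that s u x p_pos D_hom[OF that(3)] J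
    by (simp add: loc_hom_frac frac_mem_extension_iff frob_homD(2)[OF D_hom[OF that(3)]])
  have "?H \<subseteq> carrier (cartier_piece (localization R W) p e)"
    using p_pos D_hom by (auto intro: loc_hom_closed)
  then have "?L \<longleftrightarrow> (\<forall>f\<in>?H. f (loc_frac R W s u) \<in> loc_extension R W J)"
    unfolding loc_cartier_def
    using s u extension_ideal[OF J(1)] by (intro S.generate_maps_into_ideal_iff) auto
  also have "\<dots> \<longleftrightarrow> (\<forall>r\<in>carrier R. \<forall>w\<in>W. \<forall>\<phi>\<in>D e. r \<otimes> \<phi> ?x \<in> J)"
    using val by blast
  also have "\<dots> \<longleftrightarrow> ?R"
  proof
    assume "\<forall>r\<in>carrier R. \<forall>w\<in>W. \<forall>\<phi>\<in>D e. r \<otimes> \<phi> ?x \<in> J"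
    then have "\<one> \<otimes> \<phi> ?x \<in> J" if "\<phi> \<in> D e" for \<phi> using that one_closed by blast
    then show ?R using frob_homD(2)[OF D_hom x] by simp
  qed (auto intro: J.I_l_closed)
  finally show ?thesis .
qed

lemma frac_mem_core_iff:
  assumes J: "ideal J R" "saturated J" and s: "s \<in> carrier R" and u: "u \<in> W"
  shows "loc_frac R W s u \<in> cartier_core (localization R W) (loc_cartier R W p D) (loc_extension R W J)
    \<longleftrightarrow> s \<in> cartier_core R D J"
proof -
  have "(\<forall>e>0. \<forall>\<phi>\<in>D e. \<phi> (s \<otimes> u [^] (p ^ e - 1)) \<in> J) \<longleftrightarrow> s \<in> cartier_core R D J"
  proof
    assume "\<forall>e>0. \<forall>\<phi>\<in>D e. \<phi> (s \<otimes> u [^] (p ^ e - 1)) \<in> J"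
    then show "s \<in> cartier_core R D J"
      unfolding cartier_core_def using cancel_pow_pred[OF J(2) s u] s by blast
  next
    assume "s \<in> cartier_core R D J"
    then have "s \<otimes> u [^] n \<in> cartier_core R D J" for n :: nat
      using core_mult_closed[of s J "u [^] n"] s u by (simp add: m_comm W_carrier)
    then show "\<forall>e>0. \<forall>\<phi>\<in>D e. \<phi> (s \<otimes> u [^] (p ^ e - 1)) \<in> J"
      by (auto simp: cartier_core_def)
  qed
  then show ?thesis
    using frac_maps_into_extension_iff[OF assms] frac_closed[OF s u]
    unfolding cartier_core_def[of "localization R W"] by simp
qed

theorem contraction_core:
  assumes "ideal J R" "saturated J"
  shows "loc_contraction R W
      (cartier_core (localization R W) (loc_cartier R W p D) (loc_extension R W J))
    = cartier_core R D J"
  using frac_mem_core_iff[OF assms _ one_closed]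
  by (auto simp: loc_contraction_def loc_map_def cartier_core_def[of R])

theorem extension_core:
  assumes "ideal J R" "saturated J"
  shows "loc_extension R W (cartier_core R D J)
    = cartier_core (localization R W) (loc_cartier R W p D) (loc_extension R W J)"
    (is "?E = ?C")
proof -
  have core: "ideal (cartier_core R D J) R" "saturated (cartier_core R D J)"
    using assms core_ideal core_saturated by auto
  interpret E: ideal ?E "localization R W" by (rule extension_ideal[OF core(1)])
  have "x \<in> ?E \<longleftrightarrow> x \<in> ?C" if "x \<in> carrier (localization R W)" for x
    using that frac_mem_extension_iff[OF core] frac_mem_core_iff[OF assms] by (elim locE) simp
  moreover have "?C \<subseteq> carrier (localization R W)" by (auto simp: cartier_core_def)
  ultimately show ?thesis using E.a_Hcarr by blast
qed

end

theorem theorem3p8: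
  fixes R :: "('a, 'm) ring_scheme" (structure)
    and p :: nat and D :: "nat \<Rightarrow> ('a \<Rightarrow> 'a) set" and J W :: "'a set"
  assumes "cring R" and "noetherian_ring R"
    and "Factorial_Ring.prime p" and "has_char R p" and "F_finite R p"
    and "cartier_subalgebra R p D"
    and "ideal J R"
    and "submonoid W R" and "\<And>P. P \<in> Ass R J \<Longrightarrow> W \<inter> P = {}"
  shows "loc_contraction R W
           (cartier_core (localization R W) (loc_cartier R W p D) (loc_extension R W J))
         = cartier_core R D J
       \<and> loc_extension R W (cartier_core R D J)
         = cartier_core (localization R W) (loc_cartier R W p D) (loc_extension R W J)"
proof -
  interpret cring R by fact
  interpret submonoid W R by fact
  interpret cartier_subalgebra R p D by fact
  interpret cartier_localization R W p D
    by unfold_locales (use assms(3) prime_gt_0_nat in blast)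
  have "saturated J"
    unfolding saturated_def
    using nonzerodivisor_mod_if_avoids_Ass[OF assms(2,7)] W_carrier assms(9) by blast
  then show ?thesis
    using contraction_core extension_core assms(7) by blast
qed

end
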